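(* Let $\rho \geqslant 1$, let $n$ be a positive integer, and let $P = \mathrm{COR}(n)$ and $Q = Q(n)$. Then: (1) if $\rho$ is a fixed constant, then $\operatorname{xc}(P,\rho Q) = 2^{\Omega(n)}$; (2) if $\rho = O(n^\beta)$ for some constant $\beta < 1/2$, then $\operatorname{xc}(P,\rho Q) = 2^{\Omega(n^{1-2\beta})}$.
   Context: $\mathrm{COR}(n) = \mathrm{conv}\{bb^\intercal \mid b \in \{0,1\}^n\} \subseteq \mathbb{R}^{n\times n}$ is the correlation polytope. $Q(n) = \{x \in \mathbb{R}^{n\times n} \mid \langle 2\,\mathrm{diag}(a) - aa^\intercal, x\rangle \leqslant 1 \ \forall a \in \{0,1\}^n\}$, where $\langle\cdot,\cdot\rangle$ is the Frobenius inner product; $\rho Q = \{x \mid \langle 2\,\mathrm{diag}(a) - aa^\intercal, x\rangle \leqslant \rho\ \forall a\}$. For polyhedra $P \subseteq Q'$ in $\mathbb{R}^d$, an extended formulation of the pair $P,Q'$ is a system $Ex + Fy = g$, $y\geqslant \mathbf 0$, $y \in \mathbb{R}^r$, whose projection $K=\{x\mid \exists y: Ex+Fy=g, y\geqslant\mathbf 0\}$ satisfies $P \subseteq K\subseteq Q'$; its size is $r$, and $\operatorname{xc}(P,Q')$ is the minimum size of such an EF. The implied constants in $\Omega$ depend only on $\rho$ in (1), and on $\beta$ and the constant in $\rho=O(n^\beta)$ in (2). *)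

theory Defs
  imports "HOL-Analysis.Analysis"
begin

text \<open>Points of R^(n x n) are represented as functions x :: nat => nat => real
  whose entries outside {0..<n} x {0..<n} are zero.\<close>

type_synonym rmat = "nat \<Rightarrow> nat \<Rightarrow> real"

definition mat_space :: "nat \<Rightarrow> rmat set" where
  "mat_space n = {x. \<forall>i j. (n \<le> i \<or> n \<le> j) \<longrightarrow> x i j = 0}"

definition bin_vecs :: "nat \<Rightarrow> (nat \<Rightarrow> real) set" where
  "bin_vecs n = {b. \<forall>i. (i < n \<longrightarrow> b i \<in> {0, 1}) \<and> (n \<le> i \<longrightarrow> b i = 0)}"

definition frob :: "nat \<Rightarrow> rmat \<Rightarrow> rmat \<Rightarrow> real" where
  "frob n A x = (\<Sum>i<n. \<Sum>j<n. A i j * x i j)"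

definition outer :: "(nat \<Rightarrow> real) \<Rightarrow> rmat" where
  "outer b = (\<lambda>i j. b i * b j)"

definition conv_mat :: "rmat set \<Rightarrow> rmat set" where
  "conv_mat S = {x. \<exists>T u. finite T \<and> T \<noteq> {} \<and> T \<subseteq> S \<and> (\<forall>v\<in>T. 0 \<le> u v) \<and> sum u T = 1
       \<and> x = (\<lambda>i j. \<Sum>v\<in>T. u v * v i j)}"

definition COR :: "nat \<Rightarrow> rmat set" where
  "COR n = conv_mat (outer ` bin_vecs n)"

definition Qpoly :: "nat \<Rightarrow> real \<Rightarrow> rmat set" where
  "Qpoly n \<rho> = {x \<in> mat_space n. \<forall>a\<in>bin_vecs n.
      frob n (\<lambda>i j. 2 * (if i = j then a i else 0) - a i * a j) x \<le> \<rho>}"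

definition EF_proj :: "nat \<Rightarrow> nat \<Rightarrow> nat \<Rightarrow> (nat \<Rightarrow> rmat) \<Rightarrow> rmat \<Rightarrow> (nat \<Rightarrow> real) \<Rightarrow> rmat set" where
  "EF_proj n m r E F g = {x \<in> mat_space n. \<exists>y :: nat \<Rightarrow> real. (\<forall>l<r. 0 \<le> y l) \<and>
      (\<forall>k<m. frob n (E k) x + (\<Sum>l<r. F k l * y l) = g k)}"

definition has_EF :: "nat \<Rightarrow> rmat set \<Rightarrow> rmat set \<Rightarrow> nat \<Rightarrow> bool" where
  "has_EF n P Q' r \<longleftrightarrow> (\<exists>m E F g. P \<subseteq> EF_proj n m r E F g \<and> EF_proj n m r E F g \<subseteq> Q')"

definition xc :: "nat \<Rightarrow> rmat set \<Rightarrow> rmat set \<Rightarrow> nat" where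
  "xc n P Q' = (LEAST r. has_EF n P Q' r)"

end

theory Submission
  imports Defs "HOL-Real_Asymp.Real_Asymp"
begin

text \<open>An extended formulation of size $r$ yields, by linear programming duality, a factorization
  of the slack matrix $(1 - |a \cap b|)^2 + \rho - 1$ into $r + 1$ nonnegative rank-one matrices
  $f_l(a) g_l(b)$. Only the entries with $|a \cap b| = 0$ (value $\rho$) and $|a \cap b| = 1$
  (value $\rho - 1$) matter. For $T \subseteq V$ and $i \in T$, draw $a \subseteq T - \{i\}$ and
  $b \subseteq V - T$ uniformly: adding $i$ to both $a$ and $b$ lowers the average entry by exactly 1.
  For a single rank-one term, the drop caused by adding $i$ to $a$, summed over $i \in T$, is twice the
  correlation of $f$ with a sum of random signs. By Chernoff's bound this is at most $\eta n$ times the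
  average of $f$, up to an error $e^{-\eta^2 n/2} \max f / \eta$. Summing over $T$ and over the
  rank-one terms, with $\eta$ of order $1/\rho$, forces $r$ to be at least $e^{\Omega(n/\rho^2)}$
  up to polynomial factors.\<close>

section \<open>Linear programming duality\<close>

text \<open>Bartl's induction: if $\gamma$ is positive at some $q$ admissible for all $\alpha_i$, $i \in I$,
  then projecting along $q$ onto the kernel of $\alpha_j$ eliminates $\alpha_j$.\<close>

lemma farkas_combination:
  fixes comb :: "'p \<Rightarrow> real \<Rightarrow> 'p \<Rightarrow> 'p" and W :: "'p set"
    and \<alpha> :: "'i \<Rightarrow> 'p \<Rightarrow> real" and \<gamma> :: "'p \<Rightarrow> real"
  defines "lin \<equiv> \<lambda>f. \<forall>p\<in>W. \<forall>q\<in>W. \<forall>c. f (comb p c q) = f p + c * f q"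
  assumes closed: "\<And>p q c. p \<in> W \<Longrightarrow> q \<in> W \<Longrightarrow> comb p c q \<in> W"
    and "finite I" "\<And>i. i \<in> I \<Longrightarrow> lin (\<alpha> i)" "lin \<gamma>"
    and "\<And>p. p \<in> W \<Longrightarrow> (\<And>i. i \<in> I \<Longrightarrow> \<alpha> i p \<le> 0) \<Longrightarrow> \<gamma> p \<le> 0"
  shows "\<exists>u. (\<forall>i\<in>I. 0 \<le> u i) \<and> (\<forall>p\<in>W. \<gamma> p = (\<Sum>i\<in>I. u i * \<alpha> i p))"
  using assms(3-)
proof (induction I arbitrary: \<alpha> \<gamma> rule: finite_induct)
  case empty
  have "\<gamma> p = 0" if p: "p \<in> W" for p
  proof -
    \<comment> \<open>\<open>comb p (-2) p\<close> stands for the negative of \<open>p\<close>, so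
      \<open>\<gamma>\<close> is nonpositive at \<open>p\<close> and at its negative.\<close>
    have "\<gamma> (comb p (-2) p) = \<gamma> p + (-2) * \<gamma> p"
      using empty.prems(2) p unfolding lin_def by blast
    moreover have "\<gamma> (comb p (-2) p) \<le> 0" "\<gamma> p \<le> 0"
      using empty.prems(3) closed p by auto
    ultimately show ?thesis by simp
  qed
  then show ?case by simp
next
  case (insert j I)
  show ?case
  proof (cases "\<forall>p\<in>W. (\<forall>i\<in>I. \<alpha> i p \<le> 0) \<longrightarrow> \<gamma> p \<le> 0")
    \<comment> \<open>The constraint \<open>j\<close> is redundant here and gets weight 0.\<close>
    case True
    then have "\<exists>u. (\<forall>i\<in>I. 0 \<le> u i) \<and> (\<forall>p\<in>W. \<gamma> p = (\<Sum>i\<in>I. u i * \<alpha> i p))"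
      using insert.prems by (intro insert.IH) auto
    then obtain u where u: "\<forall>i\<in>I. 0 \<le> u i" "\<forall>p\<in>W. \<gamma> p = (\<Sum>i\<in>I. u i * \<alpha> i p)"
      by blast
    have "(\<Sum>i\<in>I. (u(j := 0)) i * \<alpha> i p) = (\<Sum>i\<in>I. u i * \<alpha> i p)" for p
      using insert.hyps by (intro sum.cong) auto
    then show ?thesis
      using u insert.hyps by (intro exI[of _ "u(j := 0)"]) (simp del: fun_upd_apply, simp)
  next
    case False
    then obtain q where q: "q \<in> W" "\<And>i. i \<in> I \<Longrightarrow> \<alpha> i q \<le> 0" "0 < \<gamma> q"
      by force
    \<comment> \<open>Otherwise \<open>q\<close> would satisfy all constraints, against
      \<open>0 < \<gamma> q\<close>.\<close>
    have pos: "0 < \<alpha> j q"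
      using insert.prems(3)[OF q(1)] q(2,3) by force
    have lin_shift: "lin (\<lambda>p. f p - \<alpha> j p / \<alpha> j q * f q)" if "lin f" for f
      using that insert.prems(1)[of j] unfolding lin_def
      by (auto simp: algebra_simps add_divide_distrib)
    let ?z = "\<lambda>p. comb p (- \<alpha> j p / \<alpha> j q) q"
    have z: "f (?z p) = f p - \<alpha> j p / \<alpha> j q * f q" if "lin f" "p \<in> W" for f p
      using that q(1) unfolding lin_def by simp
    have "\<exists>u. (\<forall>i\<in>I. 0 \<le> u i) \<and> (\<forall>p\<in>W. \<gamma> p - \<alpha> j p / \<alpha> j q * \<gamma> q
      = (\<Sum>i\<in>I. u i * (\<alpha> i p - \<alpha> j p / \<alpha> j q * \<alpha> i q)))"
    proof (rule insert.IH)
      fix p assume p: "p \<in> W" "\<And>i. i \<in> I \<Longrightarrow> \<alpha> i p - \<alpha> j p / \<alpha> j q * \<alpha> i q \<le> 0"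
      \<comment> \<open>\<open>\<alpha> j\<close> vanishes at \<open>?z p\<close>, and the other
        functionals take there their shifted values, nonpositive by assumption.\<close>
      have "\<gamma> (?z p) \<le> 0"
      proof (rule insert.prems(3))
        show "?z p \<in> W" using closed p(1) q(1) by blast
        show "\<alpha> i (?z p) \<le> 0" if "i \<in> insert j I" for i
          using z[OF insert.prems(1)[OF that] p(1)] p(2)[of i] that pos by auto
      qed
      then show "\<gamma> p - \<alpha> j p / \<alpha> j q * \<gamma> q \<le> 0"
        using z[OF insert.prems(2) p(1)] by simp
    qed (use lin_shift insert.prems in auto)
    then obtain u where u: "\<And>i. i \<in> I \<Longrightarrow> 0 \<le> u i"
      "\<And>p. p \<in> W \<Longrightarrow> \<gamma> p - \<alpha> j p / \<alpha> j q * \<gamma> q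
         = (\<Sum>i\<in>I. u i * (\<alpha> i p - \<alpha> j p / \<alpha> j q * \<alpha> i q))"
      by blast
    \<comment> \<open>The weight that makes the coefficients of \<open>\<alpha> j p\<close> agree.
      It is nonnegative because \<open>\<gamma> q\<close> is positive and each
      \<open>\<alpha> i q\<close> nonpositive.\<close>
    define w where "w = (\<gamma> q - (\<Sum>i\<in>I. u i * \<alpha> i q)) / \<alpha> j q"
    have "(\<Sum>i\<in>I. u i * \<alpha> i q) \<le> 0"
      using u(1) q(2) by (intro sum_nonpos) (simp add: mult_nonneg_nonpos)
    then have w: "0 \<le> w"
      using q(3) pos by (simp add: w_def)
    have "\<gamma> p = (\<Sum>i\<in>insert j I. (u(j := w)) i * \<alpha> i p)" if p: "p \<in> W" for p
    proof -
      have "(\<Sum>i\<in>insert j I. (u(j := w)) i * \<alpha> i p) = w * \<alpha> j p + (\<Sum>i\<in>I. u i * \<alpha> i p)"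
        using insert.hyps by (auto intro!: sum.cong)
      moreover have "(\<Sum>i\<in>I. u i * (\<alpha> i p - \<alpha> j p / \<alpha> j q * \<alpha> i q))
        = (\<Sum>i\<in>I. u i * \<alpha> i p) - \<alpha> j p / \<alpha> j q * (\<Sum>i\<in>I. u i * \<alpha> i q)"
        by (simp add: sum_distrib_left sum_subtractf algebra_simps)
      moreover have "w * \<alpha> j p = \<alpha> j p / \<alpha> j q * \<gamma> q - \<alpha> j p / \<alpha> j q * (\<Sum>i\<in>I. u i * \<alpha> i q)"
        by (simp add: w_def left_diff_distrib diff_divide_distrib mult.commute[of "\<alpha> j p"])
      ultimately show ?thesis
        using u(2)[OF p] by linarith
    qed
    then show ?thesis
      using u(1) w by (intro exI[of _ "u(j := w)"]) auto
  qed
qed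

section \<open>Corruption of rank-one matrices\<close>

definition avg :: "(nat set \<Rightarrow> real) \<Rightarrow> nat set \<Rightarrow> real" where
  "avg h U = (\<Sum>a\<in>Pow U. h a) / 2 ^ card U"

lemma avg_empty [simp]: "avg h {} = h {}"
  by (simp add: avg_def)

text \<open>Conditioning on the coin flip for \<open>i\<close>.\<close>

lemma avg_insert:
  assumes "finite U" "i \<notin> U"
  shows "avg h (insert i U) = (avg h U + avg (\<lambda>a. h (insert i a)) U) / 2"
proof -
  have "inj_on (insert i) (Pow U)"
    using assms(2) by (auto simp: inj_on_def)
  moreover have "Pow U \<inter> insert i ` Pow U = {}"
    using assms(2) by auto
  ultimately have "(\<Sum>a\<in>Pow (insert i U). h a) = (\<Sum>a\<in>Pow U. h a) + (\<Sum>a\<in>Pow U. h (insert i a))"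
    using assms(1) by (simp add: Pow_insert sum.union_disjoint sum.reindex)
  then show ?thesis
    using assms by (simp add: avg_def field_simps)
qed

lemma avg_add: "avg (\<lambda>a. h a + k a) U = avg h U + avg k U"
  by (simp add: avg_def sum.distrib add_divide_distrib)

lemma avg_cmult: "avg (\<lambda>a. c * h a) U = c * avg h U"
  by (simp add: avg_def sum_distrib_left)

lemma avg_sum: "avg (\<lambda>a. \<Sum>i\<in>I. h i a) U = (\<Sum>i\<in>I. avg (h i) U)"
  by (simp add: avg_def sum.swap[of _ "Pow U"] sum_divide_distrib)

lemma avg_mono: "(\<And>a. a \<subseteq> U \<Longrightarrow> h a \<le> k a) \<Longrightarrow> avg h U \<le> avg k U"
  by (auto simp: avg_def intro!: divide_right_mono sum_mono)

lemma avg_cong: "(\<And>a. a \<subseteq> U \<Longrightarrow> h a = k a) \<Longrightarrow> avg h U = avg k U"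
  by (auto simp: avg_def)

lemma avg_const [simp]: "finite U \<Longrightarrow> avg (\<lambda>_. c) U = c"
  by (simp add: avg_def card_Pow)

lemma avg_nonneg: "(\<And>a. a \<subseteq> U \<Longrightarrow> 0 \<le> h a) \<Longrightarrow> 0 \<le> avg h U"
  by (auto simp: avg_def intro!: divide_nonneg_nonneg sum_nonneg)

section \<open>Random signs and their exponential moments\<close>

definition sgn_in :: "nat \<Rightarrow> nat set \<Rightarrow> real" where
  "sgn_in i a = (if i \<in> a then -1 else 1)"

text \<open>Conditioning on membership of \<open>i\<close>. The sign is -1 on sets containing
  \<open>i\<close>, so positive correlation means that adding \<open>i\<close> lowers
  \<open>h\<close> on average; the factor 2 undoes the weight one half of each case.\<close>

lemma avg_times_sgn_in:
  assumes "finite U" "i \<in> U"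
  shows "2 * avg (\<lambda>a. h a * sgn_in i a) U
    = avg h (U - {i}) - avg (\<lambda>a. h (insert i a)) (U - {i})"
proof -
  have "avg (\<lambda>a. h a * sgn_in i a) (U - {i}) = avg h (U - {i})"
    by (rule avg_cong) (auto simp: sgn_in_def)
  moreover have "avg (\<lambda>a. h (insert i a) * sgn_in i (insert i a)) (U - {i})
    = - avg (\<lambda>a. h (insert i a)) (U - {i})"
    using avg_cmult[of "-1" "\<lambda>a. h (insert i a)" "U - {i}"] by (simp add: sgn_in_def)
  moreover have "U = insert i (U - {i})" using assms by auto
  ultimately show ?thesis
    using avg_insert[of "U - {i}" i "\<lambda>a. h a * sgn_in i a"] assms by simp
qed

text \<open>The sub-Gaussian bound for one random sign.
  \<open>exp (- (x\<^sup>2 / 2)) * cosh x\<close> is 1 at 0 and does not increase afterwards, its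
  derivative having the sign of \<open>sinh x - x * cosh x\<close>.\<close>

lemma cosh_le_exp_square:
  fixes x :: real
  assumes "0 \<le> x"
  shows "cosh x \<le> exp (x\<^sup>2 / 2)"
proof -
  have g: "0 \<le> y * cosh y - sinh y" if "0 \<le> y" for y :: real
  proof -
    have "0 * cosh 0 - sinh 0 \<le> y * cosh y - sinh y"
    proof (rule DERIV_nonneg_imp_nondecreasing[OF that])
      fix z :: real assume "0 \<le> z"
      moreover have "((\<lambda>y. y * cosh y - sinh y) has_real_derivative z * sinh z) (at z)"
        by (auto intro!: derivative_eq_intros)
      ultimately show "\<exists>d. ((\<lambda>y. y * cosh y - sinh y) has_real_derivative d) (at z) \<and> 0 \<le> d"
        by force
    qed
    then show ?thesis by simp
  qed
  have "exp (- (x\<^sup>2 / 2)) * cosh x \<le> exp (- (0\<^sup>2 / 2)) * cosh 0"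
  proof (rule DERIV_nonpos_imp_nonincreasing[OF assms])
    fix z :: real assume "0 \<le> z"
    then have "exp (- (z\<^sup>2 / 2)) * - (z * cosh z - sinh z) \<le> 0"
      using g[of z] by (intro mult_nonneg_nonpos) auto
    moreover have "((\<lambda>y. exp (- (y\<^sup>2 / 2)) * cosh y) has_real_derivative
        exp (- (z\<^sup>2 / 2)) * - (z * cosh z - sinh z)) (at z)"
      by (auto intro!: derivative_eq_intros simp: algebra_simps)
    ultimately show "\<exists>d. ((\<lambda>y. exp (- (y\<^sup>2 / 2)) * cosh y) has_real_derivative d) (at z) \<and> d \<le> 0"
      by blast
  qed
  then show ?thesis
    by (simp add: exp_minus field_simps)
qed

text \<open>The moment generating function of a sum of independent signs: each index in
  \<open>P\<close> contributes a factor \<open>cosh \<eta>\<close>, and the rest of \<open>U\<close>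
  averages out.\<close>

lemma avg_exp_sgn_in:
  assumes "finite U" "P \<subseteq> U"
  shows "avg (\<lambda>a. exp (\<eta> * (\<Sum>i\<in>P. sgn_in i a))) U = cosh \<eta> ^ card P"
  using assms
proof (induction U arbitrary: P rule: finite_induct)
  case empty
  then show ?case by simp
next
  case (insert j U)
  have IH: "avg (\<lambda>a. exp (\<eta> * (\<Sum>i\<in>P - {j}. sgn_in i a))) U = cosh \<eta> ^ card (P - {j})"
    using insert.prems by (intro insert.IH) auto
  have fin: "finite P" using insert.hyps insert.prems finite_subset by blast
  have ins: "(\<Sum>i\<in>P - {j}. sgn_in i (insert j a)) = (\<Sum>i\<in>P - {j}. sgn_in i a)" for a
    by (rule sum.cong) (auto simp: sgn_in_def)
  show ?case
  proof (cases "j \<in> P")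
    case False
    then show ?thesis
      using IH insert.hyps ins by (simp add: avg_insert)
  next
    case True
    have split: "(\<Sum>i\<in>P. sgn_in i a) = sgn_in j a + (\<Sum>i\<in>P - {j}. sgn_in i a)" for a
      using True fin by (simp add: sum.remove)
    have "sgn_in j a = 1" if "a \<subseteq> U" for a
      using that insert.hyps by (auto simp: sgn_in_def)
    then have "avg (\<lambda>a. exp (\<eta> * (\<Sum>i\<in>P. sgn_in i a))) U
      = avg (\<lambda>a. exp \<eta> * exp (\<eta> * (\<Sum>i\<in>P - {j}. sgn_in i a))) U"
      by (intro avg_cong) (simp add: split exp_add distrib_left)
    moreover have "avg (\<lambda>a. exp (\<eta> * (\<Sum>i\<in>P. sgn_in i (insert j a)))) U
      = avg (\<lambda>a. exp (- \<eta>) * exp (\<eta> * (\<Sum>i\<in>P - {j}. sgn_in i a))) U"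
      by (intro avg_cong) (auto simp: split ins, simp add: sgn_in_def exp_diff exp_minus field_simps flip: exp_add)
    ultimately have "avg (\<lambda>a. exp (\<eta> * (\<Sum>i\<in>P. sgn_in i a))) (insert j U)
      = cosh \<eta> * cosh \<eta> ^ card (P - {j})"
      using insert.hyps by (simp add: avg_insert avg_cmult IH cosh_def field_simps)
    then show ?thesis
      using True fin by (metis card.remove power_Suc)
  qed
qed

text \<open>Chernoff's bound without splitting off a tail event: pointwise, the excess of the signed
  sum over \<open>\<eta> * n\<close> is at most an exponential divided by \<open>\<eta>\<close>, and
  \<open>f\<close> is replaced by its bound \<open>s\<close> only in this error term.\<close>

lemma avg_times_sum_sgn_in_le:
  assumes "finite U" "P \<subseteq> U" "card P \<le> n" "0 < \<eta>"
    and f: "\<And>a. a \<subseteq> U \<Longrightarrow> 0 \<le> f a" "\<And>a. a \<subseteq> U \<Longrightarrow> f a \<le> s"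
  shows "avg (\<lambda>a. f a * (\<Sum>i\<in>P. sgn_in i a)) U \<le> \<eta> * n * avg f U + s / \<eta> * exp (- (\<eta>\<^sup>2 * n / 2))"
proof -
  let ?X = "\<lambda>a. \<Sum>i\<in>P. sgn_in i a"
  \<comment> \<open>The factor \<open>exp (- (\<eta>\<^sup>2 * n))\<close> comes from the shift by
    \<open>\<eta> * n\<close>; the moment bound later gives back half of its exponent.\<close>
  let ?K = "s / \<eta> * exp (- (\<eta>\<^sup>2 * n))"
  have s: "0 \<le> s" using f[of "{}"] by simp
  have "f a * ?X a \<le> \<eta> * n * f a + ?K * exp (\<eta> * ?X a)" if "a \<subseteq> U" for a
  proof -
    have "\<eta> * (?X a - \<eta> * n) \<le> exp (\<eta> * (?X a - \<eta> * n))"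
      using exp_ge_add_one_self[of "\<eta> * (?X a - \<eta> * n)"] by linarith
    then have "?X a - \<eta> * n \<le> exp (\<eta> * (?X a - \<eta> * n)) / \<eta>"
      using \<open>0 < \<eta>\<close> by (simp add: field_simps)
    then have "f a * (?X a - \<eta> * n) \<le> f a * (exp (\<eta> * (?X a - \<eta> * n)) / \<eta>)"
      using f(1)[OF that] by (rule mult_left_mono)
    also have "\<dots> \<le> s * (exp (\<eta> * (?X a - \<eta> * n)) / \<eta>)"
      using f(2)[OF that] \<open>0 < \<eta>\<close> by (intro mult_right_mono) auto
    also have "\<dots> = ?K * exp (\<eta> * ?X a)"
      by (simp add: power2_eq_square algebra_simps exp_diff exp_minus field_simps)
    finally show ?thesis by (simp add: algebra_simps)
  qed
  then have "avg (\<lambda>a. f a * ?X a) U \<le> avg (\<lambda>a. \<eta> * n * f a + ?K * exp (\<eta> * ?X a)) U"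
    by (rule avg_mono)
  also have "\<dots> = \<eta> * n * avg f U + ?K * cosh \<eta> ^ card P"
    using avg_exp_sgn_in[OF assms(1,2)] by (simp only: avg_add avg_cmult)
  also have "\<dots> \<le> \<eta> * n * avg f U + ?K * exp (\<eta>\<^sup>2 / 2) ^ n"
  proof -
    have "cosh \<eta> ^ card P \<le> exp (\<eta>\<^sup>2 / 2) ^ card P"
      using cosh_le_exp_square[of \<eta>] \<open>0 < \<eta>\<close> by (intro power_mono) auto
    also have "\<dots> \<le> exp (\<eta>\<^sup>2 / 2) ^ n"
      using \<open>card P \<le> n\<close> by (intro power_increasing) auto
    finally show ?thesis
      using s \<open>0 < \<eta>\<close> by (intro add_left_mono mult_left_mono) auto
  qed
  also have "?K * exp (\<eta>\<^sup>2 / 2) ^ n = s / \<eta> * exp (- (\<eta>\<^sup>2 * n / 2))"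
    by (simp add: exp_of_nat_mult[symmetric] field_simps flip: exp_add)
  finally show ?thesis .
qed

text \<open>Only indices with a positive drop count. Over their set \<open>P\<close> the drops add
  up to twice one correlation of \<open>f\<close> with a signed sum. The preceding bound holds for
  every \<open>P\<close>, so the dependence of \<open>P\<close> on \<open>f\<close> is
  harmless.\<close>

lemma sum_pos_part_influence_le:
  assumes "finite U" "card U \<le> n" "0 < \<eta>"
    and f: "\<And>a. a \<subseteq> U \<Longrightarrow> 0 \<le> f a" "\<And>a. a \<subseteq> U \<Longrightarrow> f a \<le> s"
  shows "(\<Sum>i\<in>U. max 0 (avg f (U - {i}) - avg (\<lambda>a. f (insert i a)) (U - {i})))
    \<le> 2 * (\<eta> * n * avg f U + s / \<eta> * exp (- (\<eta>\<^sup>2 * n / 2)))"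
proof -
  let ?d = "\<lambda>i. avg f (U - {i}) - avg (\<lambda>a. f (insert i a)) (U - {i})"
  define P where "P = {i\<in>U. 0 < ?d i}"
  have P: "P \<subseteq> U" by (auto simp: P_def)
  then have "card P \<le> n" using assms(1,2) card_mono le_trans by blast
  have "(\<Sum>i\<in>U. max 0 (?d i)) = (\<Sum>i\<in>P. max 0 (?d i))"
    using assms(1) by (intro sum.mono_neutral_right) (auto simp: P_def)
  also have "\<dots> = (\<Sum>i\<in>P. 2 * avg (\<lambda>a. f a * sgn_in i a) U)"
    using assms(1) by (intro sum.cong) (auto simp: P_def avg_times_sgn_in)
  also have "\<dots> = 2 * avg (\<lambda>a. f a * (\<Sum>i\<in>P. sgn_in i a)) U"
    by (simp add: sum_distrib_left avg_sum)
  finally show ?thesis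
    using avg_times_sum_sgn_in_le[OF assms(1) P \<open>card P \<le> n\<close> assms(3), of f s] f by simp
qed

section \<open>Drops summed over splits of the ground set\<close>

lemma sum_Pow_swap_parts:
  assumes "finite V"
  shows "(\<Sum>T\<in>Pow V. \<Sum>i\<in>T. \<phi> (T - {i}) (V - T) i) = (\<Sum>T\<in>Pow V. \<Sum>i\<in>T. \<phi> (V - T) (T - {i}) i)"
proof -
  have fin: "\<forall>T\<in>Pow V. finite T"
    using assms finite_subset by blast
  \<comment> \<open>An involution: for \<open>i \<in> T\<close> it exchanges \<open>T - {i}\<close>
    with \<open>V - T\<close> and keeps \<open>i\<close>. This later lets \<open>f\<close> and
    \<open>g\<close> trade places.\<close>
  let ?h = "\<lambda>(T, i). (insert i (V - T), i)"
  have "(\<Sum>(T, i)\<in>Sigma (Pow V) (\<lambda>T. T). \<phi> (T - {i}) (V - T) i)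
      = (\<Sum>(T, i)\<in>Sigma (Pow V) (\<lambda>T. T). \<phi> (V - T) (T - {i}) i)"
  proof (rule sum.reindex_bij_witness[of _ ?h ?h])
    fix p assume p: "p \<in> Sigma (Pow V) (\<lambda>T. T)"
    obtain T i where Ti: "p = (T, i)" by force
    have "V - insert i (V - T) = T - {i}" "insert i (V - T) - {i} = V - T"
      using p Ti by auto
    then show "(case ?h p of (T, i) \<Rightarrow> \<phi> (V - T) (T - {i}) i)
        = (case p of (T, i) \<Rightarrow> \<phi> (T - {i}) (V - T) i)"
      using Ti by simp
  qed auto
  then show ?thesis
    using assms fin by (simp add: sum.Sigma)
qed

lemma sum_card_Pow:
  assumes "finite V"
  shows "2 * (\<Sum>T\<in>Pow V. real (card T)) = card V * 2 ^ card V"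
proof -
  have "(\<Sum>T\<in>Pow V. real (card T)) = (\<Sum>T\<in>Pow V. real (card (V - T)))"
    by (rule sum.reindex_bij_witness[of _ "\<lambda>T. V - T" "\<lambda>T. V - T"]) (auto simp: double_diff)
  also have "\<dots> = (\<Sum>T\<in>Pow V. real (card V) - real (card T))"
    using assms by (intro sum.cong) (auto simp: card_Diff_subset finite_subset card_mono of_nat_diff)
  also have "\<dots> = card V * 2 ^ card V - (\<Sum>T\<in>Pow V. real (card T))"
    using assms by (simp add: sum_subtractf card_Pow)
  finally show ?thesis by simp
qed

text \<open>Changing one factor at a time. Both positive parts are multiplied by unprimed values, so
  no average with \<open>i\<close> inserted remains as a cofactor.\<close>

lemma diff_mult_le_pos_parts:
  fixes x x' y y' :: real
  assumes "0 \<le> x" "0 \<le> y" "0 \<le> x'" "0 \<le> y'"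
  shows "x * y - x' * y' \<le> max 0 (x - x') * y + x * max 0 (y - y')"
proof (cases "x' \<le> x")
  case True
  have "x * y - x' * y' = (x - x') * y + x' * (y - y')"
    by (simp add: algebra_simps)
  also have "x' * (y - y') \<le> x * max 0 (y - y')"
    using assms True mult_mono[of x' x "max 0 (y - y')" "max 0 (y - y')"]
      mult_left_mono[of "y - y'" "max 0 (y - y')" x'] by simp
  finally show ?thesis
    using True by simp
next
  case False
  have "x * y - x' * y' = x * (y - y') - (x' - x) * y'"
    by (simp add: algebra_simps)
  also have "\<dots> \<le> x * (y - y')"
    using assms False by simp
  also have "\<dots> \<le> x * max 0 (y - y')"
    using assms by (intro mult_left_mono) auto
  also have "\<dots> \<le> max 0 (x - x') * y + x * max 0 (y - y')"
    using assms by simp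
  finally show ?thesis .
qed

text \<open>The drop of the product splits into a drop of \<open>f\<close> and a drop of
  \<open>g\<close>. For fixed \<open>T\<close> the former is summed over \<open>i \<in> T\<close>
  with constant cofactor \<open>avg g (V - T)\<close>; the latter takes the same form after the
  involution on pairs of \<open>T\<close> and \<open>i\<close>.\<close>

lemma corruption_rank_one:
  fixes f g :: "nat set \<Rightarrow> real"
  assumes "finite V" "card V = n" "0 < \<eta>" "s * t \<le> B"
    and f: "\<And>a. a \<subseteq> V \<Longrightarrow> 0 \<le> f a" "\<And>a. a \<subseteq> V \<Longrightarrow> f a \<le> s"
    and g: "\<And>b. b \<subseteq> V \<Longrightarrow> 0 \<le> g b" "\<And>b. b \<subseteq> V \<Longrightarrow> g b \<le> t"
  shows "(\<Sum>T\<in>Pow V. \<Sum>i\<in>T. avg f (T - {i}) * avg g (V - T)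
      - avg (\<lambda>a. f (insert i a)) (T - {i}) * avg (\<lambda>b. g (insert i b)) (V - T))
    \<le> 4 * \<eta> * n * (\<Sum>T\<in>Pow V. avg f T * avg g (V - T))
      + 4 * 2 ^ n * (B / \<eta> * exp (- (\<eta>\<^sup>2 * n / 2)))"
proof -
  define e where "e = exp (- (\<eta>\<^sup>2 * n / 2)) / \<eta>"
  have e: "0 \<le> e" using \<open>0 < \<eta>\<close> by (simp add: e_def)
  \<comment> \<open>Stated for arbitrary \<open>h\<close> and \<open>k\<close> because it is applied
    to \<open>f\<close>, \<open>g\<close> and to \<open>g\<close>, \<open>f\<close>.\<close>
  have half: "(\<Sum>T\<in>Pow V. \<Sum>i\<in>T. max 0 (avg h (T - {i}) - avg (\<lambda>a. h (insert i a)) (T - {i})) * avg k (V - T))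
      \<le> 2 * \<eta> * n * (\<Sum>T\<in>Pow V. avg h T * avg k (V - T)) + 2 * 2 ^ n * (B * e)"
    if "s' * t' \<le> B" and h: "\<And>a. a \<subseteq> V \<Longrightarrow> 0 \<le> h a" "\<And>a. a \<subseteq> V \<Longrightarrow> h a \<le> s'"
      and k: "\<And>b. b \<subseteq> V \<Longrightarrow> 0 \<le> k b" "\<And>b. b \<subseteq> V \<Longrightarrow> k b \<le> t'" for h k :: "nat set \<Rightarrow> real" and s' t'
  proof -
    have "(\<Sum>i\<in>T. max 0 (avg h (T - {i}) - avg (\<lambda>a. h (insert i a)) (T - {i})) * avg k (V - T))
        \<le> 2 * \<eta> * n * (avg h T * avg k (V - T)) + 2 * (B * e)" if T: "T \<in> Pow V" for T
    proof -
      have fin: "finite T" "finite (V - T)" "card T \<le> n"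
        using T assms(1,2) by (auto simp: finite_subset card_mono)
      have k0: "0 \<le> avg k (V - T)"
        using k by (intro avg_nonneg) auto
      have "avg k (V - T) \<le> avg (\<lambda>_. t') (V - T)"
        using k by (intro avg_mono) auto
      then have kt: "avg k (V - T) \<le> t'"
        using fin by simp
      have "0 \<le> s'" using h[of "{}"] by simp
      \<comment> \<open>Only the product of the two bounds is controlled, so the error of
        \<open>h\<close> has to be paired with the bound \<open>t'\<close> on the average of
        \<open>k\<close>.\<close>
      then have "s' * e * avg k (V - T) \<le> s' * e * t'"
        using kt e by (intro mult_left_mono) auto
      also have "\<dots> \<le> B * e"
        using \<open>s' * t' \<le> B\<close> e mult_right_mono[of "s' * t'" B e] by (simp add: algebra_simps)
      finally have se: "s' * e * avg k (V - T) \<le> B * e" .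
      have "(\<Sum>i\<in>T. max 0 (avg h (T - {i}) - avg (\<lambda>a. h (insert i a)) (T - {i}))) \<le> 2 * (\<eta> * n * avg h T + s' * e)"
        using sum_pos_part_influence_le[OF fin(1,3) \<open>0 < \<eta>\<close>, of h s'] T h by (simp add: e_def subset_trans)
      from mult_right_mono[OF this k0]
      have "(\<Sum>i\<in>T. max 0 (avg h (T - {i}) - avg (\<lambda>a. h (insert i a)) (T - {i})) * avg k (V - T))
          \<le> 2 * (\<eta> * n * avg h T + s' * e) * avg k (V - T)"
        by (simp only: sum_distrib_right)
      also have "\<dots> = 2 * \<eta> * n * (avg h T * avg k (V - T)) + 2 * (s' * e * avg k (V - T))"
        by (simp add: algebra_simps)
      finally show ?thesis
        using se by linarith
    qed
    then have "(\<Sum>T\<in>Pow V. \<Sum>i\<in>T. max 0 (avg h (T - {i}) - avg (\<lambda>a. h (insert i a)) (T - {i})) * avg k (V - T))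
        \<le> (\<Sum>T\<in>Pow V. 2 * \<eta> * n * (avg h T * avg k (V - T)) + 2 * (B * e))"
      by (rule sum_mono)
    also have "\<dots> = 2 * \<eta> * n * (\<Sum>T\<in>Pow V. avg h T * avg k (V - T)) + 2 * 2 ^ n * (B * e)"
      using assms(1,2) by (simp add: sum.distrib sum_distrib_left card_Pow)
    finally show ?thesis .
  qed
  let ?df = "\<lambda>T i. max 0 (avg f (T - {i}) - avg (\<lambda>a. f (insert i a)) (T - {i})) * avg g (V - T)"
  let ?dg = "\<lambda>T i. avg f (T - {i}) * max 0 (avg g (V - T) - avg (\<lambda>b. g (insert i b)) (V - T))"
  let ?dg' = "\<lambda>T i. max 0 (avg g (T - {i}) - avg (\<lambda>b. g (insert i b)) (T - {i})) * avg f (V - T)"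
  have "(\<Sum>T\<in>Pow V. \<Sum>i\<in>T. avg f (T - {i}) * avg g (V - T)
      - avg (\<lambda>a. f (insert i a)) (T - {i}) * avg (\<lambda>b. g (insert i b)) (V - T))
      \<le> (\<Sum>T\<in>Pow V. \<Sum>i\<in>T. ?df T i + ?dg T i)"
  proof (intro sum_mono diff_mult_le_pos_parts avg_nonneg)
    fix T i a assume "T \<in> Pow V" "i \<in> T"
    then show "a \<subseteq> T - {i} \<Longrightarrow> 0 \<le> f a" "a \<subseteq> T - {i} \<Longrightarrow> 0 \<le> f (insert i a)"
      "a \<subseteq> V - T \<Longrightarrow> 0 \<le> g a" "a \<subseteq> V - T \<Longrightarrow> 0 \<le> g (insert i a)"
      by (auto intro!: f g)
  qed
  also have "\<dots> = (\<Sum>T\<in>Pow V. \<Sum>i\<in>T. ?df T i) + (\<Sum>T\<in>Pow V. \<Sum>i\<in>T. ?dg T i)"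
    by (simp add: sum.distrib)
  also have "(\<Sum>T\<in>Pow V. \<Sum>i\<in>T. ?dg T i) = (\<Sum>T\<in>Pow V. \<Sum>i\<in>T. ?dg' T i)"
    using sum_Pow_swap_parts[OF assms(1),
        of "\<lambda>A B i. avg f A * max 0 (avg g B - avg (\<lambda>b. g (insert i b)) B)"]
    by (simp add: mult.commute)
  also have "(\<Sum>T\<in>Pow V. \<Sum>i\<in>T. ?df T i) + (\<Sum>T\<in>Pow V. \<Sum>i\<in>T. ?dg' T i)
      \<le> (2 * \<eta> * n * (\<Sum>T\<in>Pow V. avg f T * avg g (V - T)) + 2 * 2 ^ n * (B * e))
        + (2 * \<eta> * n * (\<Sum>T\<in>Pow V. avg g T * avg f (V - T)) + 2 * 2 ^ n * (B * e))"
    by (intro add_mono half[of s t f g] half[of t s g f]) (use assms(4) f g in \<open>auto simp: mult.commute\<close>)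
  \<comment> \<open>Complementing \<open>T\<close> identifies the two main terms.\<close>
  also have "(\<Sum>T\<in>Pow V. avg g T * avg f (V - T)) = (\<Sum>T\<in>Pow V. avg f T * avg g (V - T))"
    by (rule sum.reindex_bij_witness[of _ "\<lambda>T. V - T" "\<lambda>T. V - T"])
      (auto simp: double_diff mult.commute)
  finally show ?thesis
    by (simp add: e_def algebra_simps)
qed

text \<open>A product of averages is the average over an independent pair; summing over
  \<open>l\<close> inside it recovers a matrix that is constant on this rectangle.\<close>

lemma sum_avg_mult_avg:
  assumes "finite A" "finite B" "\<And>a b. a \<subseteq> A \<Longrightarrow> b \<subseteq> B \<Longrightarrow> (\<Sum>l\<in>L. f l a * g l b) = c"
  shows "(\<Sum>l\<in>L. avg (f l) A * avg (g l) B) = c"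
proof -
  have "avg (f l) A * avg (g l) B = avg (\<lambda>a. avg (\<lambda>b. f l a * g l b) B) A" for l
    using avg_cmult[of "avg (g l) B" "f l" A] by (simp add: avg_cmult mult.commute)
  then have "(\<Sum>l\<in>L. avg (f l) A * avg (g l) B) = avg (\<lambda>a. avg (\<lambda>b. \<Sum>l\<in>L. f l a * g l b) B) A"
    by (simp add: avg_sum)
  also have "\<dots> = avg (\<lambda>_. avg (\<lambda>_. c) B) A"
    using assms(3) by (intro avg_cong)
  finally show ?thesis
    using assms(1,2) by simp
qed

text \<open>Double counting of the drop caused by inserting \<open>i\<close> on both sides: summed
  over \<open>l\<close> it is exactly 1 for each \<open>i \<in> T\<close>, hence
  \<open>n * 2 ^ (n - 1)\<close> over all \<open>T\<close>, while the rank-one bounds cap the same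
  total.\<close>

lemma shifted_disjointness_factorization_bound:
  fixes f g :: "'l \<Rightarrow> nat set \<Rightarrow> real" and \<rho> :: real
  assumes V: "finite V" "card V = n" "0 < n" and "1 \<le> \<rho>"
    and L: "finite L"
    and nonneg: "\<And>l a. l \<in> L \<Longrightarrow> a \<subseteq> V \<Longrightarrow> 0 \<le> f l a" "\<And>l b. l \<in> L \<Longrightarrow> b \<subseteq> V \<Longrightarrow> 0 \<le> g l b"
    and slack: "\<And>a b. a \<subseteq> V \<Longrightarrow> b \<subseteq> V
      \<Longrightarrow> (\<Sum>l\<in>L. f l a * g l b) = (1 - real (card (a \<inter> b)))\<^sup>2 + \<rho> - 1"
  shows "n \<le> 256 * \<rho> * ((real n)\<^sup>2 + \<rho>) * card L * exp (- (n / (512 * \<rho>\<^sup>2)))"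
proof -
  define B where "B = (real n)\<^sup>2 + \<rho>"
  \<comment> \<open>This value makes the main term below equal to \<open>n / 2\<close>, half of the
    left side, and \<open>\<eta>\<^sup>2 / 2\<close> equal to
    \<open>1 / (512 * \<rho>\<^sup>2)\<close>.\<close>
  define \<eta> where "\<eta> = 1 / (16 * \<rho>)"
  define err where "err = B / \<eta> * exp (- (\<eta>\<^sup>2 * n / 2))"
  have \<eta>: "0 < \<eta>" using \<open>1 \<le> \<rho>\<close> by (simp add: \<eta>_def)
  have entry_le: "f l a * g l b \<le> B" if "l \<in> L" "a \<subseteq> V" "b \<subseteq> V" for l a b
  proof -
    have "f l a * g l b \<le> (\<Sum>l\<in>L. f l a * g l b)"
      using that L nonneg by (intro member_le_sum) auto
    also have "\<dots> = (1 - real (card (a \<inter> b)))\<^sup>2 + \<rho> - 1"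
      using slack that by simp
    also have "\<dots> \<le> real n ^ 2 + \<rho>"
    proof -
      have "card (a \<inter> b) \<le> n"
        using that V by (metis card_mono le_infI1)
      \<comment> \<open>For an empty intersection this uses \<open>0 < n\<close>.\<close>
      then have "\<bar>1 - real (card (a \<inter> b))\<bar> \<le> \<bar>real n\<bar>"
        using V(3) by auto
      then have "(1 - real (card (a \<inter> b)))\<^sup>2 \<le> (real n)\<^sup>2"
        by (rule abs_le_square_iff[THEN iffD1])
      then show ?thesis by simp
    qed
    finally show ?thesis by (simp add: B_def)
  qed
  have rank_one: "(\<Sum>T\<in>Pow V. \<Sum>i\<in>T. avg (f l) (T - {i}) * avg (g l) (V - T)
      - avg (\<lambda>a. f l (insert i a)) (T - {i}) * avg (\<lambda>b. g l (insert i b)) (V - T))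
    \<le> 4 * \<eta> * n * (\<Sum>T\<in>Pow V. avg (f l) T * avg (g l) (V - T)) + 4 * 2 ^ n * err"
    if l: "l \<in> L" for l
  proof -
    have fin: "finite (h ` Pow V)" "h ` Pow V \<noteq> {}" for h :: "nat set \<Rightarrow> real"
      using V(1) by auto
    \<comment> \<open>The product of the two maxima is itself an entry of the rank-one term, so
      \<open>B\<close> bounds it however the factors are scaled.\<close>
    obtain a b where "a \<subseteq> V" "b \<subseteq> V" "f l a = Max (f l ` Pow V)" "g l b = Max (g l ` Pow V)"
      using Max_in[OF fin, of "f l"] Max_in[OF fin, of "g l"] by fastforce
    then have "Max (f l ` Pow V) * Max (g l ` Pow V) \<le> B"
      using entry_le[OF l] by metis
    then show ?thesis
      unfolding err_def
      by (rule corruption_rank_one[OF V(1,2) \<eta>]) (use nonneg l V(1) in auto)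
  qed
  have F0: "(\<Sum>l\<in>L. avg (f l) A * avg (g l) B) = \<rho>" if "A \<subseteq> V" "B \<subseteq> V" "A \<inter> B = {}" for A B
  proof (rule sum_avg_mult_avg)
    fix a b assume ab: "a \<subseteq> A" "b \<subseteq> B"
    then have "a \<inter> b = {}" using that by auto
    then show "(\<Sum>l\<in>L. f l a * g l b) = \<rho>"
      using ab that slack[of a b] by auto
  qed (use that V(1) finite_subset in blast)+
  \<comment> \<open>Inserting \<open>i\<close> on both sides turns disjoint pairs into pairs meeting
    exactly in \<open>i\<close>.\<close>
  have F1: "(\<Sum>l\<in>L. avg (\<lambda>a. f l (insert i a)) (T - {i}) * avg (\<lambda>b. g l (insert i b)) (V - T)) = \<rho> - 1"
    if "T \<subseteq> V" "i \<in> T" for T i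
  proof (rule sum_avg_mult_avg)
    fix a b assume ab: "a \<subseteq> T - {i}" "b \<subseteq> V - T"
    then have "insert i a \<inter> insert i b = {i}" by auto
    then have "card (insert i a \<inter> insert i b) = 1" by (simp only: is_singletonI flip: is_singleton_altdef)
    moreover have "insert i a \<subseteq> V" "insert i b \<subseteq> V" using that ab by auto
    ultimately show "(\<Sum>l\<in>L. f l (insert i a) * g l (insert i b)) = \<rho> - 1"
      using slack[of "insert i a" "insert i b"] by (simp del: Int_insert_left_if0 Int_insert_left_if1 Int_insert_right_if0 Int_insert_right_if1)
  qed (use that V(1) finite_subset in blast)+
  have "(\<Sum>T\<in>Pow V. real (card T)) = (\<Sum>T\<in>Pow V. \<Sum>i\<in>T. \<Sum>l\<in>L. avg (f l) (T - {i}) * avg (g l) (V - T)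
      - avg (\<lambda>a. f l (insert i a)) (T - {i}) * avg (\<lambda>b. g l (insert i b)) (V - T))"
  proof (rule sum.cong)
    fix T assume T: "T \<in> Pow V"
    have "(\<Sum>l\<in>L. avg (f l) (T - {i}) * avg (g l) (V - T)
      - avg (\<lambda>a. f l (insert i a)) (T - {i}) * avg (\<lambda>b. g l (insert i b)) (V - T)) = 1"
      if "i \<in> T" for i
      using T that F0[of "T - {i}" "V - T"] F1[of T i] by (auto simp: sum_subtractf)
    then show "real (card T) = (\<Sum>i\<in>T. \<Sum>l\<in>L. avg (f l) (T - {i}) * avg (g l) (V - T)
      - avg (\<lambda>a. f l (insert i a)) (T - {i}) * avg (\<lambda>b. g l (insert i b)) (V - T))"
      by simp
  qed simp
  also have "\<dots> = (\<Sum>l\<in>L. \<Sum>T\<in>Pow V. \<Sum>i\<in>T. avg (f l) (T - {i}) * avg (g l) (V - T)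
      - avg (\<lambda>a. f l (insert i a)) (T - {i}) * avg (\<lambda>b. g l (insert i b)) (V - T))"
    by (simp add: sum.swap[of _ L])
  also have "\<dots> \<le> (\<Sum>l\<in>L. 4 * \<eta> * n * (\<Sum>T\<in>Pow V. avg (f l) T * avg (g l) (V - T)) + 4 * 2 ^ n * err)"
    by (intro sum_mono rank_one)
  also have "\<dots> = 4 * \<eta> * n * (\<Sum>T\<in>Pow V. \<Sum>l\<in>L. avg (f l) T * avg (g l) (V - T)) + 4 * 2 ^ n * err * card L"
    by (simp add: sum.distrib sum_distrib_left sum.swap[of _ _ L])
  also have "(\<Sum>T\<in>Pow V. \<Sum>l\<in>L. avg (f l) T * avg (g l) (V - T)) = 2 ^ n * \<rho>"
    using V F0 by (simp add: card_Pow Diff_disjoint)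
  finally have "n * 2 ^ n \<le> 2 * (4 * \<eta> * n * (2 ^ n * \<rho>) + 4 * 2 ^ n * err * card L)"
    using sum_card_Pow[OF V(1)] V(2) by simp
  then have "2 ^ n * real n \<le> 2 ^ n * (8 * \<eta> * n * \<rho> + 8 * err * card L)"
    by (simp add: algebra_simps)
  then have "n \<le> 8 * \<eta> * n * \<rho> + 8 * err * card L"
    by (rule mult_left_le_imp_le) simp
  moreover have "8 * \<eta> * n * \<rho> = n / 2"
    using \<open>1 \<le> \<rho>\<close> by (simp add: \<eta>_def)
  ultimately have "n \<le> n / 2 + 8 * err * card L"
    by simp
  then have "n \<le> 16 * (err * real (card L))"
    by (simp only: mult.assoc)
  also have "err = 16 * \<rho> * B * exp (- (n / (512 * \<rho>\<^sup>2)))"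
    using \<open>1 \<le> \<rho>\<close> by (simp add: err_def \<eta>_def power_mult_distrib power_divide)
  finally show ?thesis
    by (simp add: B_def algebra_simps)
qed


section \<open>Extended formulations of the correlation polytope\<close>

lemma bin_vecs_eq: "bin_vecs n = indicator ` Pow {..<n}"
proof (intro equalityI subsetI)
  fix b assume b: "b \<in> bin_vecs n"
  then have "b = indicator {i. i < n \<and> b i = 1}"
    by (fastforce simp: bin_vecs_def indicator_def fun_eq_iff not_le)
  then show "b \<in> indicator ` Pow {..<n}" by auto
qed (auto simp: bin_vecs_def indicator_def)

text \<open>Spelled as in \<open>Qpoly\<close>, so that the two match syntactically.\<close>

abbreviation facet_mat :: "(nat \<Rightarrow> real) \<Rightarrow> rmat" where
  "facet_mat a \<equiv> \<lambda>i j. 2 * (if i = j then a i else 0) - a i * a j"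

text \<open>Entries 0 and 1 are idempotent, so with k the size of the intersection the diagonal part
  gives 2k and the rank-one part k^2.\<close>

lemma frob_facet_outer:
  assumes "a \<subseteq> {..<n}" "b \<subseteq> {..<n}"
  shows "frob n (facet_mat (indicator a)) (outer (indicator b)) = 1 - (1 - real (card (a \<inter> b)))\<^sup>2"
proof -
  let ?a = "indicator a :: nat \<Rightarrow> real" and ?b = "indicator b :: nat \<Rightarrow> real"
  have card: "(\<Sum>i<n. ?a i * ?b i) = real (card (a \<inter> b))"
  proof -
    have "(\<Sum>i<n. ?a i * ?b i) = (\<Sum>i<n. indicator (a \<inter> b) i)"
      by (simp add: indicator_inter_arith)
    also have "\<dots> = real (card (a \<inter> b))"
    proof -
      have "(\<Sum>i<n. indicator (a \<inter> b) i) = (\<Sum>i\<in>a \<inter> b. 1 :: real)"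
        using assms by (intro sum.mono_neutral_cong_right) (auto simp: indicator_def)
      then show ?thesis by simp
    qed
    finally show ?thesis .
  qed
  define c where "c i = ?a i * ?b i" for i
  have "frob n (facet_mat ?a) (outer ?b)
    = (\<Sum>i<n. \<Sum>j<n. 2 * (if i = j then c i else 0) - c i * c j)"
    unfolding frob_def outer_def c_def by (intro sum.cong) (auto simp: indicator_def)
  also have "\<dots> = 2 * (\<Sum>i<n. c i) - (\<Sum>i<n. c i) * (\<Sum>j<n. c j)"
    by (simp add: sum_subtractf sum_product sum_distrib_left[symmetric])
  finally show ?thesis
    by (simp add: c_def card power2_eq_square algebra_simps)
qed

lemma outer_in_mat_space: "b \<in> bin_vecs n \<Longrightarrow> outer b \<in> mat_space n"
  by (auto simp: bin_vecs_def mat_space_def outer_def)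

lemma outer_in_COR: "b \<in> bin_vecs n \<Longrightarrow> outer b \<in> COR n"
  unfolding COR_def conv_mat_def
  by (intro CollectI exI[of _ "{outer b}"] exI[of _ "\<lambda>_. 1"]) auto

lemma frob_sum_right: "frob n A (\<lambda>i j. \<Sum>l\<in>L. y l * M l i j) = (\<Sum>l\<in>L. y l * frob n A (M l))"
proof -
  have "frob n A (\<lambda>i j. \<Sum>l\<in>L. y l * M l i j) = (\<Sum>i<n. \<Sum>j<n. \<Sum>l\<in>L. y l * (A i j * M l i j))"
    by (simp add: frob_def sum_distrib_left algebra_simps)
  also have "\<dots> = (\<Sum>i<n. \<Sum>l\<in>L. \<Sum>j<n. y l * (A i j * M l i j))"
    by (intro sum.cong sum.swap) simp
  also have "\<dots> = (\<Sum>l\<in>L. \<Sum>i<n. \<Sum>j<n. y l * (A i j * M l i j))"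
    by (rule sum.swap)
  finally show ?thesis
    by (simp add: frob_def sum_distrib_left)
qed

text \<open>Linearity in the shape of the combination used for duality; with \<open>x\<close> zero
  it also gives scaling.\<close>

lemma frob_add_scaled: "frob n A (\<lambda>i j. x i j + c * x' i j) = frob n A x + c * frob n A x'"
  by (simp add: frob_def distrib_left sum.distrib sum_distrib_left algebra_simps)

lemma frob_unit:
  assumes "p < n" "q < n"
  shows "frob n (\<lambda>i j. if i = p \<and> j = q then 1 else 0) x = x p q"
proof -
  have "frob n (\<lambda>i j. if i = p \<and> j = q then 1 else 0) x
    = (\<Sum>i<n. if i = p then (\<Sum>j<n. if j = q then x i j else 0) else 0)"
    unfolding frob_def by (intro sum.cong) (auto simp: if_distrib[of "\<lambda>c. c * _"] cong: if_cong)
  then show ?thesis using assms by simp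
qed

text \<open>Without this, \<^const>\<open>xc\<close> would be the \<open>LEAST\<close> of an empty predicate. The
  formulation has one variable per vertex; equation \<open>k < n * n\<close> handles entry
  \<open>(k div n, k mod n)\<close>.\<close>

lemma EF_COR_exists:
  assumes "1 \<le> \<rho>"
  shows "\<exists>r. has_EF n (COR n) (Qpoly n \<rho>) r"
proof -
  let ?S = "outer ` bin_vecs n"
  define N where "N = card ?S"
  have finS: "finite ?S"
    by (simp add: bin_vecs_eq)
  then obtain h where h: "bij_betw h {..<N} ?S"
    using ex_bij_betw_nat_finite[of ?S] by (auto simp: N_def atLeast0LessThan)
  have hS: "h l \<in> ?S" if "l < N" for l
    using h that by (auto simp: bij_betw_def)
  \<comment> \<open>Equations below \<open>n * n\<close> equate an entry of \<open>x\<close> with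
    the combination of vertices; equation \<open>n * n\<close> normalizes the weights.\<close>
  define E where "E k = (\<lambda>i j. if k < n * n \<and> i = k div n \<and> j = k mod n then 1 else 0 :: real)" for k :: nat
  define F where "F k l = (if k < n * n then - h l (k div n) (k mod n) else 1)" for k l :: nat
  define g where "g k = (if k < n * n then 0 else 1 :: real)" for k :: nat
  have proj: "x \<in> EF_proj n (n * n + 1) N E F g \<longleftrightarrow> x \<in> mat_space n \<and>
      (\<exists>y. (\<forall>l<N. 0 \<le> y l) \<and> (\<Sum>l<N. y l) = 1 \<and> x = (\<lambda>i j. \<Sum>l<N. y l * h l i j))" for x
  proof -
    have "(\<forall>k<n * n + 1. frob n (E k) x + (\<Sum>l<N. F k l * y l) = g k) \<longleftrightarrow>
      (\<Sum>l<N. y l) = 1 \<and> x = (\<lambda>i j. \<Sum>l<N. y l * h l i j)" if x: "x \<in> mat_space n" for y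
    proof -
      have last: "frob n (E (n * n)) x + (\<Sum>l<N. F (n * n) l * y l) = (\<Sum>l<N. y l)"
        by (simp add: frob_def E_def F_def)
      have entry: "frob n (E k) x + (\<Sum>l<N. F k l * y l)
          = x (k div n) (k mod n) - (\<Sum>l<N. y l * h l (k div n) (k mod n))"
        if "k < n * n" for k
      proof -
        have "k div n < n" "k mod n < n"
          using that by (cases "n = 0"; simp add: less_mult_imp_div_less)+
        then show ?thesis
          using that frob_unit[of "k div n" n "k mod n" x]
          by (simp add: E_def F_def sum_negf mult.commute)
      qed
      have "(\<forall>k<n * n. x (k div n) (k mod n) = (\<Sum>l<N. y l * h l (k div n) (k mod n)))
        \<longleftrightarrow> x = (\<lambda>i j. \<Sum>l<N. y l * h l i j)"
      proof
        assume eq: "\<forall>k<n * n. x (k div n) (k mod n) = (\<Sum>l<N. y l * h l (k div n) (k mod n))"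
        show "x = (\<lambda>i j. \<Sum>l<N. y l * h l i j)"
        proof (intro ext)
          fix i j
          show "x i j = (\<Sum>l<N. y l * h l i j)"
          proof (cases "i < n \<and> j < n")
            case True
            \<comment> \<open>\<open>i * n + j\<close> is the equation whose quotient and remainder
              by \<open>n\<close> are \<open>i\<close> and \<open>j\<close>.\<close>
            then have "i * n + j < Suc i * n" by simp
            also have "\<dots> \<le> n * n" using True by (intro mult_right_mono) auto
            finally have "i * n + j < n * n" .
            then show ?thesis
              using eq[rule_format, of "i * n + j"] True by simp
          next
            case False
            then have "h l i j = 0" if "l < N" for l
              using hS[OF that] outer_in_mat_space False by (auto simp: mat_space_def not_less)
            then show ?thesis
              using x False by (auto simp: mat_space_def not_less)
          qed
        qed
      qed auto
      then show ?thesis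
        using last entry by (auto simp: less_Suc_eq g_def)
    qed
    then show ?thesis
      unfolding EF_proj_def by blast
  qed
  have "COR n \<subseteq> EF_proj n (n * n + 1) N E F g"
  proof
    fix x assume "x \<in> COR n"
    then obtain T u where T: "finite T" "T \<subseteq> ?S" "\<forall>v\<in>T. 0 \<le> u v" "sum u T = 1"
      "x = (\<lambda>i j. \<Sum>v\<in>T. u v * v i j)"
      unfolding COR_def conv_mat_def by blast
    \<comment> \<open>The weights carried over along \<open>h\<close>, with 0 at vertices outside
      \<open>T\<close>.\<close>
    define y where "y l = (if h l \<in> T then u (h l) else 0)" for l
    have sum: "(\<Sum>l<N. y l * \<phi> (h l)) = (\<Sum>v\<in>T. u v * \<phi> v)" for \<phi> :: "rmat \<Rightarrow> real"
    proof -
      have "(\<Sum>l<N. y l * \<phi> (h l)) = (\<Sum>v\<in>?S. if v \<in> T then u v * \<phi> v else 0)"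
        unfolding y_def
        by (subst sum.reindex_bij_betw[OF h, symmetric]) (intro sum.cong, auto)
      also have "\<dots> = (\<Sum>v\<in>T. u v * \<phi> v)"
        using T(2) finS by (simp add: sum.If_cases Int_absorb1)
      finally show ?thesis .
    qed
    have "(\<Sum>l<N. y l) = 1"
      using sum[of "\<lambda>_. 1"] T(4) by simp
    moreover have "x = (\<lambda>i j. \<Sum>l<N. y l * h l i j)"
      using sum[of "\<lambda>v. v _ _"] T(5) by simp
    moreover have "x \<in> mat_space n"
    proof -
      have "v i j = 0" if "v \<in> T" "n \<le> i \<or> n \<le> j" for v i j
      proof -
        have "v \<in> mat_space n" using that(1) T(2) outer_in_mat_space by blast
        then show ?thesis using that(2) by (auto simp: mat_space_def)
      qed
      then show ?thesis
        unfolding T(5) mat_space_def by (simp add: sum.neutral)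
    qed
    moreover have "\<forall>l<N. 0 \<le> y l"
      using T(3) by (simp add: y_def)
    ultimately show "x \<in> EF_proj n (n * n + 1) N E F g"
      unfolding proj by blast
  qed
  moreover have "EF_proj n (n * n + 1) N E F g \<subseteq> Qpoly n \<rho>"
  proof
    fix x assume "x \<in> EF_proj n (n * n + 1) N E F g"
    then obtain y where y: "x \<in> mat_space n" "\<forall>l<N. 0 \<le> y l" "(\<Sum>l<N. y l) = 1"
      "x = (\<lambda>i j. \<Sum>l<N. y l * h l i j)"
      unfolding proj by blast
    have "frob n (facet_mat a) x \<le> \<rho>" if a: "a \<in> bin_vecs n" for a
    proof -
      \<comment> \<open>On a vertex the value is 1 minus a square; convexity and
        \<open>1 \<le> \<rho>\<close> do the rest.\<close>
      have "frob n (facet_mat a) (h l) \<le> 1" if l: "l < N" for l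
      proof -
        obtain a' b' where ab: "a' \<subseteq> {..<n}" "b' \<subseteq> {..<n}"
          "a = indicator a'" "h l = outer (indicator b')"
          using hS[OF l] a unfolding bin_vecs_eq by blast
        show ?thesis unfolding ab(3,4) frob_facet_outer[OF ab(1,2)] by simp
      qed
      then have "(\<Sum>l<N. y l * frob n (facet_mat a) (h l)) \<le> (\<Sum>l<N. y l * 1)"
        using y(2) by (intro sum_mono mult_left_mono) auto
      then show ?thesis
        using y(3,4) assms by (simp add: frob_sum_right)
    qed
    then show "x \<in> Qpoly n \<rho>"
      using y(1) by (simp add: Qpoly_def)
  qed
  ultimately show ?thesis
    unfolding has_EF_def by blast
qed

text \<open>The proof homogenizes with a coordinate $t \ge 0$. Points with $t = 0$ are recession
  directions; the inequality for them follows by moving from \<open>x0\<close> along them.\<close>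

lemma EF_slack_certificate:
  assumes ne: "x0 \<in> EF_proj n m r E F g"
    and valid: "\<And>x. x \<in> EF_proj n m r E F g \<Longrightarrow> frob n A x \<le> \<rho>"
  shows "\<exists>u. (\<forall>l\<le>r. 0 \<le> u l) \<and> (\<forall>x\<in>mat_space n. \<forall>y.
    (\<forall>k<m. frob n (E k) x + (\<Sum>l<r. F k l * y l) = g k)
      \<longrightarrow> \<rho> - frob n A x = (\<Sum>l<r. u l * y l) + u r)"
proof -
  \<comment> \<open>Only the homogenized equations; nonnegativity enters through the functionals
    \<open>\<alpha>\<close>, where index \<open>r\<close> stands for \<open>t\<close>.\<close>
  define W :: "(rmat \<times> (nat \<Rightarrow> real) \<times> real) set" where
    "W = {(x, y, t). x \<in> mat_space n \<and> (\<forall>k<m. frob n (E k) x + (\<Sum>l<r. F k l * y l) = t * g k)}"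
  define comb :: "rmat \<times> (nat \<Rightarrow> real) \<times> real \<Rightarrow> real \<Rightarrow> _ \<Rightarrow> _" where
    "comb = (\<lambda>(x, y, t) c (x', y', t').
      ((\<lambda>i j. x i j + c * x' i j), (\<lambda>l. y l + c * y' l), t + c * t'))"
  define \<alpha> :: "nat \<Rightarrow> rmat \<times> (nat \<Rightarrow> real) \<times> real \<Rightarrow> real" where
    "\<alpha> l = (\<lambda>(x, y, t). if l < r then - y l else - t)" for l
  define \<gamma> :: "rmat \<times> (nat \<Rightarrow> real) \<times> real \<Rightarrow> real" where
    "\<gamma> = (\<lambda>(x, y, t). frob n A x - \<rho> * t)"
  have closed: "comb p c q \<in> W" if "p \<in> W" "q \<in> W" for p q c
  proof -
    obtain x y t x' y' t' where "p = (x, y, t)" "q = (x', y', t')"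
      by (metis prod_cases3)
    moreover have "frob n (E k) (\<lambda>i j. x i j + c * x' i j) + (\<Sum>l<r. F k l * (y l + c * y' l))
      = (frob n (E k) x + (\<Sum>l<r. F k l * y l)) + c * (frob n (E k) x' + (\<Sum>l<r. F k l * y' l))" for k
      by (simp add: frob_add_scaled distrib_left sum.distrib sum_distrib_left algebra_simps)
    ultimately show ?thesis
      using that by (auto simp: W_def comb_def mat_space_def distrib_right mult.assoc)
  qed
  have nonpos: "\<gamma> p \<le> 0" if p: "p \<in> W" "\<And>l. l \<in> {..r} \<Longrightarrow> \<alpha> l p \<le> 0" for p
  proof -
    obtain x y t where xyt: "p = (x, y, t)" by (metis prod_cases3)
    have y: "0 \<le> y l" if "l < r" for l
      using p(2)[of l] that by (simp add: \<alpha>_def xyt)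
    have t: "0 \<le> t"
      using p(2)[of r] by (simp add: \<alpha>_def xyt)
    obtain y0 where y0: "x0 \<in> mat_space n" "\<forall>l<r. 0 \<le> y0 l"
      "\<forall>k<m. frob n (E k) x0 + (\<Sum>l<r. F k l * y0 l) = g k"
      using ne by (auto simp: EF_proj_def)
    have w0: "(x0, y0, 1) \<in> W"
      using y0 by (simp add: W_def)
    \<comment> \<open>Dividing the point reached from \<open>(x0, y0, 1)\<close> by its last
      coordinate \<open>d\<close> gives a point of the projection. As \<open>d\<close> is positive
      for every \<open>t \<ge> 0\<close>, the cases of zero and positive \<open>t\<close> are
      treated together.\<close>
    have scaled: "frob n A x0 + s * frob n A x \<le> \<rho> * (1 + s * t)" if s: "0 \<le> s" for s
    proof -
      define d where "d = 1 + s * t"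
      have d: "0 < d" using s t by (simp add: d_def add_pos_nonneg)
      let ?x = "\<lambda>i j. x0 i j + s * x i j" and ?y = "\<lambda>l. y0 l + s * y l"
      have W1: "(?x, ?y, d) \<in> W"
        using closed[OF w0 p(1), of s] by (simp add: comb_def xyt d_def)
      let ?z = "\<lambda>i j. 0 + (1 / d) * ?x i j"
      have fz: "frob n M ?z = (1 / d) * frob n M ?x" for M
        using frob_add_scaled[of n M "\<lambda>_ _. 0" "1 / d" ?x] by (simp add: frob_def)
      have "?z \<in> EF_proj n m r E F g"
        unfolding EF_proj_def
      proof (intro CollectI conjI exI[of _ "\<lambda>l. ?y l / d"] allI impI)
        show "?z \<in> mat_space n"
          using W1 by (simp add: W_def mat_space_def)
        show "0 \<le> ?y l / d" if "l < r" for l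
          using y y0(2) s d that by simp
        fix k assume "k < m"
        then have "frob n (E k) ?x + (\<Sum>l<r. F k l * ?y l) = d * g k"
          using W1 by (simp add: W_def)
        then have "(frob n (E k) ?x + (\<Sum>l<r. F k l * ?y l)) / d = g k"
          using d by simp
        moreover have "(\<Sum>l<r. F k l * (?y l / d)) = (\<Sum>l<r. F k l * ?y l) / d"
          by (simp only: sum_divide_distrib times_divide_eq_right)
        ultimately show "frob n (E k) ?z + (\<Sum>l<r. F k l * (?y l / d)) = g k"
          unfolding fz by (simp only: add_divide_distrib times_divide_eq_left mult_1_left)
      qed
      from valid[OF this] have "frob n A ?x \<le> \<rho> * d"
        unfolding fz using d by (simp add: field_simps)
      then show ?thesis
        by (simp add: frob_add_scaled d_def)
    qed
    show ?thesis
    proof (rule ccontr)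
      assume "\<not> ?thesis"
      then have pos: "0 < \<gamma> p" by simp
      \<comment> \<open>Large enough that \<open>s * \<gamma> p\<close> exceeds
        \<open>\<rho> - frob n A x0\<close>.\<close>
      define s where "s = (\<bar>\<rho> - frob n A x0\<bar> + 1) / \<gamma> p"
      have "0 \<le> s" using pos by (simp add: s_def)
      from scaled[OF this] have "s * \<gamma> p \<le> \<rho> - frob n A x0"
        by (simp add: \<gamma>_def xyt algebra_simps)
      moreover have "s * \<gamma> p = \<bar>\<rho> - frob n A x0\<bar> + 1"
        using pos by (simp add: s_def)
      ultimately show False by linarith
    qed
  qed
  have "\<exists>u. (\<forall>l\<in>{..r}. 0 \<le> u l) \<and> (\<forall>p\<in>W. \<gamma> p = (\<Sum>l\<in>{..r}. u l * \<alpha> l p))"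
  proof (rule farkas_combination[OF closed])
    show "\<forall>p\<in>W. \<forall>q\<in>W. \<forall>c. \<alpha> l (comb p c q) = \<alpha> l p + c * \<alpha> l q" for l
      by (auto simp: \<alpha>_def comb_def)
    show "\<forall>p\<in>W. \<forall>q\<in>W. \<forall>c. \<gamma> (comb p c q) = \<gamma> p + c * \<gamma> q"
      by (auto simp: \<gamma>_def comb_def frob_add_scaled algebra_simps)
  qed (use nonpos in auto)
  then obtain u where u: "\<forall>l\<le>r. 0 \<le> u l" "\<forall>p\<in>W. \<gamma> p = (\<Sum>l\<le>r. u l * \<alpha> l p)"
    by auto
  have "\<rho> - frob n A x = (\<Sum>l<r. u l * y l) + u r"
    if "x \<in> mat_space n" "\<forall>k<m. frob n (E k) x + (\<Sum>l<r. F k l * y l) = g k" for x y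
  proof -
    \<comment> \<open>Setting \<open>t\<close> to 1 dehomogenizes, and the multiplier of
      \<open>t\<close> becomes the constant \<open>u r\<close>.\<close>
    have "\<gamma> (x, y, 1) = (\<Sum>l\<le>r. u l * \<alpha> l (x, y, 1))"
      using that u(2) by (simp add: W_def)
    also have "\<dots> = (\<Sum>l<r. u l * \<alpha> l (x, y, 1)) + u r * \<alpha> r (x, y, 1)"
      by (simp add: lessThan_Suc_atMost[symmetric])
    also have "\<dots> = - (\<Sum>l<r. u l * y l) - u r"
      by (simp add: \<alpha>_def sum_negf)
    finally show ?thesis by (simp add: \<gamma>_def)
  qed
  then show ?thesis using u(1) by blast
qed

text \<open>Row functions are the dual multipliers for the inequality of \<open>a\<close>; column
  functions are a nonnegative lift of the vertex of \<open>b\<close>. The extra index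
  \<open>r\<close>, with column function 1, carries the constant of the certificate.\<close>

lemma EF_slack_factorization:
  assumes "has_EF n (COR n) (Qpoly n \<rho>) r"
  shows "\<exists>f g. (\<forall>l\<le>r. \<forall>a\<subseteq>{..<n}. 0 \<le> f l a) \<and> (\<forall>l\<le>r. \<forall>b\<subseteq>{..<n}. 0 \<le> g l b) \<and>
    (\<forall>a\<subseteq>{..<n}. \<forall>b\<subseteq>{..<n}.
      (\<Sum>l\<le>r. f l a * g l b) = (1 - real (card (a \<inter> b)))\<^sup>2 + \<rho> - (1::real))"
proof -
  obtain m E F d where EF: "COR n \<subseteq> EF_proj n m r E F d" "EF_proj n m r E F d \<subseteq> Qpoly n \<rho>"
    using assms by (auto simp: has_EF_def)
  have in_EF: "outer (indicator b) \<in> EF_proj n m r E F d" if "b \<subseteq> {..<n}" for b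
    using that EF(1) outer_in_COR[of "indicator b" n] by (auto simp: bin_vecs_eq)
  have "\<forall>b\<in>Pow {..<n}. \<exists>y. (\<forall>l<r. 0 \<le> y l) \<and>
      (\<forall>k<m. frob n (E k) (outer (indicator b)) + (\<Sum>l<r. F k l * y l) = d k)"
    using in_EF unfolding EF_proj_def by blast
  from bchoice[OF this] obtain Y where Y: "\<forall>b\<in>Pow {..<n}. (\<forall>l<r. 0 \<le> Y b l) \<and>
      (\<forall>k<m. frob n (E k) (outer (indicator b)) + (\<Sum>l<r. F k l * Y b l) = d k)"
    by blast
  have "\<forall>a\<in>Pow {..<n}. \<exists>u. (\<forall>l\<le>r. 0 \<le> u l) \<and> (\<forall>x\<in>mat_space n. \<forall>y.
    (\<forall>k<m. frob n (E k) x + (\<Sum>l<r. F k l * y l) = d k)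
      \<longrightarrow> \<rho> - frob n (facet_mat (indicator a)) x = (\<Sum>l<r. u l * y l) + u r)"
  proof
    fix a assume "a \<in> Pow {..<n}"
    then have "indicator a \<in> bin_vecs n"
      by (simp add: bin_vecs_eq)
    then have "frob n (facet_mat (indicator a)) x \<le> \<rho>" if "x \<in> EF_proj n m r E F d" for x
      using that EF(2) unfolding Qpoly_def by blast
    \<comment> \<open>The vertex of the empty set shows that the projection is nonempty.\<close>
    then show "\<exists>u. (\<forall>l\<le>r. 0 \<le> u l) \<and> (\<forall>x\<in>mat_space n. \<forall>y.
      (\<forall>k<m. frob n (E k) x + (\<Sum>l<r. F k l * y l) = d k)
        \<longrightarrow> \<rho> - frob n (facet_mat (indicator a)) x = (\<Sum>l<r. u l * y l) + u r)"
      by (rule EF_slack_certificate[OF in_EF[of "{}", simplified]])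
  qed
  from bchoice[OF this] obtain U where U: "\<forall>a\<in>Pow {..<n}. (\<forall>l\<le>r. 0 \<le> U a l) \<and>
    (\<forall>x\<in>mat_space n. \<forall>y. (\<forall>k<m. frob n (E k) x + (\<Sum>l<r. F k l * y l) = d k)
      \<longrightarrow> \<rho> - frob n (facet_mat (indicator a)) x = (\<Sum>l<r. U a l * y l) + U a r)"
    by blast
  define g where "g l b = (if l < r then Y b l else 1)" for l b
  have "(\<Sum>l\<le>r. U a l * g l b) = (1 - real (card (a \<inter> b)))\<^sup>2 + \<rho> - 1"
    if ab: "a \<subseteq> {..<n}" "b \<subseteq> {..<n}" for a b
  proof -
    have "(\<Sum>l\<le>r. U a l * g l b) = (\<Sum>l<r. U a l * Y b l) + U a r"
      by (simp add: lessThan_Suc_atMost[symmetric] g_def)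
    also have "\<dots> = \<rho> - frob n (facet_mat (indicator a)) (outer (indicator b))"
    proof -
      have "outer (indicator b) \<in> mat_space n"
        using ab by (intro outer_in_mat_space) (auto simp: bin_vecs_eq)
      moreover have "\<forall>k<m. frob n (E k) (outer (indicator b)) + (\<Sum>l<r. F k l * Y b l) = d k"
        using Y ab by blast
      ultimately have "\<rho> - frob n (facet_mat (indicator a)) (outer (indicator b)) = (\<Sum>l<r. U a l * Y b l) + U a r"
        using U ab(1) by blast
      then show ?thesis by simp
    qed
    finally show ?thesis
      using frob_facet_outer[OF ab] by simp
  qed
  then show ?thesis
    using U Y by (intro exI[of _ "\<lambda>l a. U a l"] exI[of _ g]) (simp add: g_def)
qed

section \<open>The exponential lower bounds\<close>

lemma xc_lower_bound:
  assumes "1 \<le> \<rho>" "0 < n"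
  shows "n * exp (n / (512 * \<rho>\<^sup>2))
    \<le> 256 * \<rho> * ((real n)\<^sup>2 + \<rho>) * (real (xc n (COR n) (Qpoly n \<rho>)) + 1)"
proof -
  let ?r = "xc n (COR n) (Qpoly n \<rho>)"
  \<comment> \<open>The minimum is attained because some formulation exists.\<close>
  have "has_EF n (COR n) (Qpoly n \<rho>) ?r"
    unfolding xc_def using EF_COR_exists[OF assms(1)] by (rule LeastI_ex)
  from EF_slack_factorization[OF this] obtain f g where fg:
    "\<forall>l\<le>?r. \<forall>a\<subseteq>{..<n}. 0 \<le> f l a" "\<forall>l\<le>?r. \<forall>b\<subseteq>{..<n}. 0 \<le> g l b"
    "\<forall>a\<subseteq>{..<n}. \<forall>b\<subseteq>{..<n}. (\<Sum>l\<le>?r. f l a * g l b) = (1 - real (card (a \<inter> b)))\<^sup>2 + \<rho> - (1::real)"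
    by (elim exE conjE)
  \<comment> \<open>The extra term of the factorization is the source of the final
    \<open>+ 1\<close>.\<close>
  have "n \<le> 256 * \<rho> * ((real n)\<^sup>2 + \<rho>) * card {..?r} * exp (- (n / (512 * \<rho>\<^sup>2)))"
  proof (rule shifted_disjointness_factorization_bound)
    show "0 \<le> f l a" if "l \<in> {..?r}" "a \<subseteq> {..<n}" for l a
      using fg(1) that by blast
    show "0 \<le> g l b" if "l \<in> {..?r}" "b \<subseteq> {..<n}" for l b
      using fg(2) that by blast
    show "(\<Sum>l\<le>?r. f l a * g l b) = (1 - real (card (a \<inter> b)))\<^sup>2 + \<rho> - 1"
      if "a \<subseteq> {..<n}" "b \<subseteq> {..<n}" for a b
      using fg(3) that by blast
  qed (use assms in simp_all)
  from mult_right_mono[OF this, of "exp (n / (512 * \<rho>\<^sup>2))"]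
  have "n * exp (n / (512 * \<rho>\<^sup>2)) \<le> 256 * \<rho> * ((real n)\<^sup>2 + \<rho>) * card {..?r}"
    by (simp add: mult.assoc flip: exp_add)
  then show ?thesis by (simp add: add.commute)
qed

text \<open>The exponent \<open>n / (512 * \<rho>\<^sup>2)\<close> is at least a constant times
  \<open>real n powr (1 - 2 * \<beta>)\<close>, and half of that absorbs the polynomial factors.
  \<open>c\<close> and \<open>N\<close> are chosen before \<open>\<rho>\<close>, which may therefore
  vary with \<open>n\<close>.\<close>

lemma xc_lower_bound_powr:
  fixes \<beta> C :: real
  assumes "\<beta> < 1/2" "0 < C"
  shows "\<exists>c>0. \<exists>N. \<forall>n\<ge>N. 0 < n \<longrightarrow> (\<forall>\<rho>::real. 1 \<le> \<rho> \<longrightarrow> \<rho> \<le> C * real n powr \<beta> \<longrightarrow>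
    real (xc n (COR n) (Qpoly n \<rho>)) \<ge> 2 powr (c * real n powr (1 - 2 * \<beta>)))"
proof -
  define K where "K = 1 / (512 * C\<^sup>2)"
  define \<delta> where "\<delta> = 1 - 2 * \<beta>"
  \<comment> \<open>Once \<open>\<rho> \<le> C * n\<close>, the factor
    \<open>256 * \<rho> * (n^2 + \<rho>)\<close> is at most \<open>D * n^3\<close>.\<close>
  define D where "D = 256 * C * (1 + C)"
  have pos: "0 < K" "0 < \<delta>" "0 < D"
    using assms by (auto simp: K_def \<delta>_def D_def)
  have "eventually (\<lambda>n. 2 * D * real n ^ 2 \<le> exp (K / 2 * real n powr \<delta>)) at_top"
    using pos by real_asymp
  then obtain N where N: "\<And>n. N \<le> n \<Longrightarrow> 2 * D * real n ^ 2 \<le> exp (K / 2 * real n powr \<delta>)"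
    by (auto simp: eventually_at_top_linorder)
  have "2 powr (K / 2 * real n powr \<delta>) \<le> real (xc n (COR n) (Qpoly n \<rho>))"
    if n: "N \<le> n" "0 < n" and \<rho>: "1 \<le> \<rho>" "\<rho> \<le> C * real n powr \<beta>" for n \<rho>
  proof -
    let ?R = "real (xc n (COR n) (Qpoly n \<rho>)) + 1"
    \<comment> \<open>\<open>w\<close> takes half of the exponent: of the two factors in
      \<open>w * w\<close>, one pays for the polynomial and the other remains.\<close>
    define w where "w = exp (K / 2 * real n powr \<delta>)"
    have w: "1 \<le> w" using pos by (simp add: w_def)
    have "C * real n powr \<beta> \<le> C * real n powr 1"
      using n assms by (intro mult_left_mono powr_mono) auto
    then have \<rho>n: "\<rho> \<le> C * n"
      using \<rho>(2) by simp
    have "\<rho>\<^sup>2 \<le> (C * real n powr \<beta>)\<^sup>2"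
      using \<rho> by (intro power_mono) auto
    also have "\<dots> = C\<^sup>2 * real n powr (2 * \<beta>)"
      using n by (simp add: power_mult_distrib power2_eq_square flip: powr_add)
    finally have "n / (512 * (C\<^sup>2 * real n powr (2 * \<beta>))) \<le> n / (512 * \<rho>\<^sup>2)"
      using \<rho>(1) n(2) assms(2) by (intro divide_left_mono mult_left_mono) auto
    moreover have "n / (512 * (C\<^sup>2 * real n powr (2 * \<beta>))) = K * real n powr \<delta>"
      using n by (simp add: K_def \<delta>_def powr_diff)
    ultimately have "w * w \<le> exp (n / (512 * \<rho>\<^sup>2))"
      by (simp add: w_def flip: exp_add)
    then have "n * (w * w) \<le> n * exp (n / (512 * \<rho>\<^sup>2))"
      by (intro mult_left_mono) auto
    also have "\<dots> \<le> 256 * \<rho> * ((real n)\<^sup>2 + \<rho>) * ?R"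
      using xc_lower_bound[OF \<rho>(1) n(2)] by simp
    also have "\<dots> \<le> 256 * (C * n) * ((real n)\<^sup>2 + C * (real n)\<^sup>2) * ?R"
    proof -
      have "C * real n \<le> C * (real n)\<^sup>2"
        using n assms(2) by (intro mult_left_mono) (auto simp: power2_eq_square)
      then show ?thesis
        using \<rho>n \<rho>(1) by (intro mult_right_mono mult_mono) auto
    qed
    also have "\<dots> = n * (D * (real n)\<^sup>2 * ?R)"
      by (simp add: D_def algebra_simps power2_eq_square)
    finally have "w * w \<le> D * (real n)\<^sup>2 * ?R"
      using n by simp
    also have "\<dots> \<le> w / 2 * ?R"
      using N[OF n(1)] by (intro mult_right_mono) (auto simp: w_def)
    finally have "w * w \<le> w * (?R / 2)" by simp
    \<comment> \<open>\<open>?R\<close> exceeds the complexity by 1; the second copy of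
      \<open>w\<close> absorbs this since \<open>1 \<le> w\<close>.\<close>
    then have "2 * w \<le> ?R"
      using w by simp
    moreover have "2 powr (K / 2 * real n powr \<delta>) \<le> w"
    proof -
      have "ln 2 \<le> (1::real)" using ln_2_less_1 by simp
      then have "K / 2 * real n powr \<delta> * ln 2 \<le> K / 2 * real n powr \<delta> * 1"
        using pos by (intro mult_left_mono) auto
      then show ?thesis by (simp add: powr_def[of 2] w_def)
    qed
    ultimately show ?thesis using w by linarith
  qed
  then show ?thesis
    using pos by (intro exI[of _ "K / 2"] conjI exI[of _ N]) (auto simp: \<delta>_def)
qed

theorem theorem6:
  shows "(\<forall>\<rho>::real. 1 \<le> \<rho> \<longrightarrow>
           (\<exists>c>0. \<exists>N. \<forall>n\<ge>N. 0 < n \<longrightarrow>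
              real (xc n (COR n) (Qpoly n \<rho>)) \<ge> 2 powr (c * real n)))
       \<and> (\<forall>(\<beta>::real) (C::real). \<beta> < 1/2 \<longrightarrow> 0 < C \<longrightarrow>
           (\<exists>c>0. \<exists>N. \<forall>n\<ge>N. 0 < n \<longrightarrow> (\<forall>\<rho>::real. 1 \<le> \<rho> \<longrightarrow> \<rho> \<le> C * real n powr \<beta> \<longrightarrow>
              real (xc n (COR n) (Qpoly n \<rho>)) \<ge> 2 powr (c * real n powr (1 - 2 * \<beta>)))))"
proof (intro conjI allI impI)
  \<comment> \<open>Constant \<open>\<rho>\<close> is the case of exponent 0 with
    \<open>C = \<rho>\<close>, since \<open>real n powr 0 = 1\<close> for positive
    \<open>n\<close>.\<close>
  fix \<rho> :: real assume "1 \<le> \<rho>"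
  then show "\<exists>c>0. \<exists>N. \<forall>n\<ge>N. 0 < n \<longrightarrow>
      real (xc n (COR n) (Qpoly n \<rho>)) \<ge> 2 powr (c * real n)"
    using xc_lower_bound_powr[of 0 \<rho>] by fastforce
qed (rule xc_lower_bound_powr)

end
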